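(* Let $\alpha\in\mathbb{C}$ satisfy $\alpha^2=\frac{1+2i}{\sqrt5}$. Let $\phi$ be a holomorphic function of $(z_1,z_2)$ on an open subset $U\subset\mathbb{C}^2$ satisfying $$\Big|\frac{\partial^2\phi}{\partial z_1^2}\Big|^2-\Big|\frac{\partial^2\phi}{\partial z_2^2}\Big|^2=0,$$ and let $$L_\phi=\Big\{\Big(z_1,z_2,\frac{\partial\phi}{\partial z_1},\frac{\partial\phi}{\partial z_2}\Big):(z_1,z_2)\in U\Big\}\subset\mathbb{C}^4 .$$ Let $F:T^*\mathbb{R}^4\to\mathbb{C}^4$, $F(q,p)=(z_1,z_2,u_1,u_2)$, be the map $$z_1=\frac{\alpha q_1+(-1+i)\alpha q_2+(1-i)\alpha^{-1}p_1-i\alpha^{-1}p_2}{i\sqrt2},\qquad z_2=\frac{\alpha q_3+(-1+i)\alpha q_4-(1-i)\alpha^{-1}p_3+i\alpha^{-1}p_4}{\sqrt2},$$ $$u_1=\frac{\alpha q_1+(-1+i)\alpha q_2-(1-i)\alpha^{-1}p_1+i\alpha^{-1}p_2}{i\sqrt2},\qquad u_2=\frac{\alpha q_3+(-1+i)\alpha q_4+(1-i)\alpha^{-1}p_3-i\alpha^{-1}p_4}{\sqrt2}.$$ Then $F^{-1}(L_\phi)$ is a special lagrangian submanifold of $(T^*\mathbb{R}^4,\Omega,\omega_{SLAG})$.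
   Context: $T^*\mathbb{R}^4\cong\mathbb{R}^8$ has coordinates $(q,p)=(q_1,\dots,q_4,p_1,\dots,p_4)$ and symplectic form $\Omega=\sum_{j=1}^4 dq_j\wedge dp_j$. Set $$\omega_{SLAG}=\operatorname{Im}\big((dq_1+i\,dp_1)\wedge(dq_2+i\,dp_2)\wedge(dq_3+i\,dp_3)\wedge(dq_4+i\,dp_4)\big).$$ A real $4$-dimensional submanifold $L\subset T^*\mathbb{R}^4$ is special lagrangian in $(T^*\mathbb{R}^4,\Omega,\omega_{SLAG})$ if $\Omega|_L=0$ and $\omega_{SLAG}|_L=0$. *)

theory Defs
  imports "HOL-Complex_Analysis.Complex_Analysis"
begin

text \<open>Meant for \<^emph>\<open>open\<close> sets \<open>S\<close> of a Euclidean space, where this is the usual notion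
  of \<open>C\<^sup>k\<close> and \<open>C\<^sup>\<infinity>\<close>.\<close>

primrec Ck_on :: "nat \<Rightarrow> 'a::euclidean_space set \<Rightarrow> ('a \<Rightarrow> 'b::euclidean_space) \<Rightarrow> bool" where
  "Ck_on 0 S f \<longleftrightarrow> continuous_on S f"
| "Ck_on (Suc k) S f \<longleftrightarrow>
     f differentiable_on S \<and> (\<forall>v. Ck_on k S (\<lambda>x. frechet_derivative f (at x) v))"

definition smooth_on :: "'a::euclidean_space set \<Rightarrow> ('a \<Rightarrow> 'b::euclidean_space) \<Rightarrow> bool" where
  "smooth_on S f \<longleftrightarrow> (\<forall>k. Ck_on k S f)"

definition diffeomorphism :: "'a::euclidean_space set \<Rightarrow> 'a set \<Rightarrow> ('a \<Rightarrow> 'a) \<Rightarrow> ('a \<Rightarrow> 'a) \<Rightarrow> bool" where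
  "diffeomorphism V W h h' \<longleftrightarrow>
     open V \<and> open W \<and> homeomorphism V W h h' \<and> smooth_on V h \<and> smooth_on W h'"

text \<open>Smooth embedded submanifolds of dimension \<open>k\<close>, by slice charts of the ambient space.\<close>

definition embedded_submanifold :: "nat \<Rightarrow> 'a::euclidean_space set \<Rightarrow> bool" where
  "embedded_submanifold k L \<longleftrightarrow>
     (\<forall>x\<in>L. \<exists>V W h h' S. x \<in> V \<and> diffeomorphism V W h h' \<and>
        subspace S \<and> dim S = k \<and> h ` (L \<inter> V) = W \<inter> S)"

text \<open>Velocities at \<open>x\<close> of curves lying in \<open>L\<close>. Differentiability is only required at time \<open>0\<close>; for an
  embedded submanifold this gives the same tangent space as smooth curves.\<close>

definition tangent_space :: "'a::real_normed_vector set \<Rightarrow> 'a \<Rightarrow> 'a set" where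
  "tangent_space L x =
     {v. \<exists>\<gamma> :: real \<Rightarrow> 'a. \<gamma> 0 = x \<and> (\<forall>\<^sub>F t in nhds 0. \<gamma> t \<in> L) \<and>
        (\<gamma> has_vector_derivative v) (at 0)}"

type_synonym cotangent4 = "(real ^ 4) \<times> (real ^ 4)"

definition dq :: "4 \<Rightarrow> cotangent4 \<Rightarrow> real" where
  "dq j v = fst v $ j"

definition dp :: "4 \<Rightarrow> cotangent4 \<Rightarrow> real" where
  "dp j v = snd v $ j"

text \<open>The wedge of the one-forms \<open>\<theta> i\<close> evaluated on the vectors \<open>v j\<close>, normalised without factorials.\<close>

definition wedge :: "('n::finite \<Rightarrow> 'v \<Rightarrow> 'k::comm_ring_1) \<Rightarrow> ('n \<Rightarrow> 'v) \<Rightarrow> 'k" where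
  "wedge \<theta> v = det (\<chi> i j. \<theta> i (v j))"

definition Omega :: "cotangent4 \<Rightarrow> cotangent4 \<Rightarrow> real" where
  "Omega v w = (\<Sum>j\<in>UNIV. dq j v * dp j w - dq j w * dp j v)"

definition omega_SLAG :: "(4 \<Rightarrow> cotangent4) \<Rightarrow> real" where
  "omega_SLAG v = Im (wedge (\<lambda>j w. of_real (dq j w) + \<i> * of_real (dp j w)) v)"

definition special_lagrangian :: "cotangent4 set \<Rightarrow> bool" where
  "special_lagrangian L \<longleftrightarrow>
     embedded_submanifold 4 L \<and>
     (\<forall>x\<in>L. \<forall>v\<in>tangent_space L x. \<forall>w\<in>tangent_space L x. Omega v w = 0) \<and>
     (\<forall>x\<in>L. \<forall>v. (\<forall>j. v j \<in> tangent_space L x) \<longrightarrow> omega_SLAG v = 0)"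

text \<open>Complex differentiability: a real derivative exists at every point and is \<open>\<complex>\<close>-linear.\<close>

definition holomorphic2_on :: "(complex \<times> complex \<Rightarrow> complex) \<Rightarrow> (complex \<times> complex) set \<Rightarrow> bool" where
  "holomorphic2_on \<phi> U \<longleftrightarrow>
     (\<forall>z\<in>U. \<exists>a b. (\<phi> has_derivative (\<lambda>h. a * fst h + b * snd h)) (at z))"

definition pd1 :: "(complex \<times> complex \<Rightarrow> complex) \<Rightarrow> complex \<times> complex \<Rightarrow> complex" where
  "pd1 \<phi> z = deriv (\<lambda>w. \<phi> (w, snd z)) (fst z)"

definition pd2 :: "(complex \<times> complex \<Rightarrow> complex) \<Rightarrow> complex \<times> complex \<Rightarrow> complex" where
  "pd2 \<phi> z = deriv (\<lambda>w. \<phi> (fst z, w)) (snd z)"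

definition L_graph ::
  "(complex \<times> complex \<Rightarrow> complex) \<Rightarrow> (complex \<times> complex) set \<Rightarrow> (complex \<times> complex \<times> complex \<times> complex) set"
  where "L_graph \<phi> U = {(z1, z2, pd1 \<phi> (z1, z2), pd2 \<phi> (z1, z2)) | z1 z2. (z1, z2) \<in> U}"

definition F_map :: "complex \<Rightarrow> cotangent4 \<Rightarrow> complex \<times> complex \<times> complex \<times> complex" where
  "F_map \<alpha> = (\<lambda>(q, p). let
       q1 = of_real (q $ 1); q2 = of_real (q $ 2); q3 = of_real (q $ 3); q4 = of_real (q $ 4);
       p1 = of_real (p $ 1); p2 = of_real (p $ 2); p3 = of_real (p $ 3); p4 = of_real (p $ 4);
       r = of_real (sqrt 2)
     in
      ((\<alpha> * q1 + (-1 + \<i>) * \<alpha> * q2 + (1 - \<i>) * inverse \<alpha> * p1 - \<i> * inverse \<alpha> * p2) / (\<i> * r),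
       (\<alpha> * q3 + (-1 + \<i>) * \<alpha> * q4 - (1 - \<i>) * inverse \<alpha> * p3 + \<i> * inverse \<alpha> * p4) / r,
       (\<alpha> * q1 + (-1 + \<i>) * \<alpha> * q2 - (1 - \<i>) * inverse \<alpha> * p1 + \<i> * inverse \<alpha> * p2) / (\<i> * r),
       (\<alpha> * q3 + (-1 + \<i>) * \<alpha> * q4 + (1 - \<i>) * inverse \<alpha> * p3 - \<i> * inverse \<alpha> * p4) / r))"

end

theory Submission
  imports Defs
begin

text \<open>With \<open>dz1 \<and> du1 + dz2 \<and> du2\<close> pulled back along \<open>F\<close>, the real part is \<open>\<Omega>\<close>, so the graph of the
  gradient of \<open>\<phi>\<close> is Lagrangian because the mixed second derivatives of \<open>\<phi>\<close> agree. Since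
  \<open>\<surd>5 \<alpha>\<^sup>2 = 1 + 2\<i>\<close> and \<open>\<bar>\<alpha>\<bar> = 1\<close>, the product of the first two, respectively the last two, of the forms
  \<open>dq\<^sub>j + \<i> dp\<^sub>j\<close> is
  \<open>\<i>/2 (dz \<and> dz' + du \<and> du') - 3/4 (dz \<and> du - dz' \<and> du') - \<epsilon> \<surd>5/4 (dz \<and> dz' - du \<and> du')\<close>, a prime
  denoting conjugation, with \<open>\<epsilon> = 1\<close> and \<open>\<epsilon> = -1\<close>. On a tangent space of the graph the imaginary part of
  the product of the two is a multiple of \<open>\<bar>\<phi>\<^sub>1\<^sub>1\<bar>\<^sup>2 - \<bar>\<phi>\<^sub>2\<^sub>2\<bar>\<^sup>2\<close>. Slice charts are the shears
  \<open>(z, u) \<mapsto> (z, u - \<nabla>\<phi> z)\<close>, which are smooth because the partial derivatives of a holomorphic function are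
  again holomorphic, by Cauchy's integral formula and differentiation under the integral.\<close>

subsection \<open>Holomorphic functions of two variables\<close>

text \<open>For open \<open>U\<close> this is again holomorphy, by Osgood's lemma. This form can be
  checked for partial derivatives one variable at a time, and the built-in continuity lets Cauchy
  integrals be treated as parameter integrals.\<close>

definition separately_holomorphic_on :: "(complex \<times> complex \<Rightarrow> complex) \<Rightarrow> (complex \<times> complex) set \<Rightarrow> bool" where
  "separately_holomorphic_on f U \<longleftrightarrow> continuous_on U f \<and>
     (\<forall>z\<in>U. (\<lambda>w. f (w, snd z)) field_differentiable at (fst z) \<and>
             (\<lambda>w. f (fst z, w)) field_differentiable at (snd z))"

lemma holomorphic2_imp_separately:
  assumes "holomorphic2_on f U"
  shows "separately_holomorphic_on f U"
  unfolding separately_holomorphic_on_def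
proof (intro conjI ballI)
  have diff: "\<exists>a b. (f has_derivative (\<lambda>h. a * fst h + b * snd h)) (at z)" if "z \<in> U" for z
    using assms that by (auto simp: holomorphic2_on_def)
  show "continuous_on U f"
    by (meson diff continuous_at_imp_continuous_on has_derivative_continuous)
  fix z assume "z \<in> U"
  then obtain a b where ab: "(f has_derivative (\<lambda>h. a * fst h + b * snd h)) (at (fst z, snd z))"
    using diff[of z] by auto
  have "((\<lambda>w. f (w, snd z)) has_derivative (\<lambda>h. a * fst (h, 0::complex) + b * snd (h, 0::complex))) (at (fst z))"
    by (rule has_derivative_compose[of "\<lambda>w. (w, snd z)" _ _ _ f, OF _ ab])
       (auto intro!: derivative_eq_intros)
  then show "(\<lambda>w. f (w, snd z)) field_differentiable at (fst z)"
    by (auto simp: field_differentiable_def has_field_derivative_def)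
  have "((\<lambda>w. f (fst z, w)) has_derivative (\<lambda>h. a * fst (0::complex, h) + b * snd (0::complex, h))) (at (snd z))"
    by (rule has_derivative_compose[of "\<lambda>w. (fst z, w)" _ _ _ f, OF _ ab])
       (auto intro!: derivative_eq_intros)
  then show "(\<lambda>w. f (fst z, w)) field_differentiable at (snd z)"
    by (auto simp: field_differentiable_def has_field_derivative_def)
qed

text \<open>Exchanging the variables turns results on \<open>pd1\<close> into results on
  \<open>pd2\<close>, so that Cauchy's formula is worked out in the first variable only.\<close>

lemma separately_holomorphic_swap:
  assumes "separately_holomorphic_on f U"
  shows "separately_holomorphic_on (f \<circ> prod.swap) (prod.swap -` U)"
  using assms unfolding separately_holomorphic_on_def prod.swap_def o_def
  by (auto intro!: continuous_on_compose2[of U f] continuous_intros)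

lemma pd1_swap: "pd1 (f \<circ> prod.swap) z = pd2 f (prod.swap z)"
  by (simp add: pd1_def pd2_def)

lemma open_swap_vimage: "open U \<Longrightarrow> open (prod.swap -` U :: (complex \<times> complex) set)"
  by (rule open_vimage) (auto simp: prod.swap_def intro!: continuous_intros)

lemma separately_holomorphic_subset:
  "separately_holomorphic_on f U \<Longrightarrow> V \<subseteq> U \<Longrightarrow> separately_holomorphic_on f V"
  by (auto simp: separately_holomorphic_on_def intro: continuous_on_subset)

lemma separately_holomorphic_has_pd:
  assumes "separately_holomorphic_on f U" "(x, y) \<in> U"
  shows "((\<lambda>w. f (w, y)) has_field_derivative pd1 f (x, y)) (at x)"
    and "((\<lambda>w. f (x, w)) has_field_derivative pd2 f (x, y)) (at y)"
  using assms by (fastforce simp: separately_holomorphic_on_def pd1_def pd2_def DERIV_deriv_iff_field_differentiable)+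

section \<open>Cauchy integrals on polydiscs\<close>

lemma open_contains_polydisc:
  fixes U :: "(complex \<times> complex) set"
  assumes "open U" "(a, b) \<in> U"
  obtains r where "r > 0" "cball a r \<times> cball b r \<subseteq> U"
proof -
  obtain A B where AB: "open A" "open B" "a \<in> A" "b \<in> B" "A \<times> B \<subseteq> U"
    using assms by (auto elim!: open_prod_elim)
  obtain r s where "r > 0" "cball a r \<subseteq> A" "s > 0" "cball b s \<subseteq> B"
    using AB by (meson open_contains_cball)
  then have "min r s > 0" "cball a (min r s) \<times> cball b (min r s) \<subseteq> U"
    using AB(5) by (auto simp: subset_iff)
  then show thesis using that by blast
qed

text \<open>Cauchy's formula for the derivative, with the second variable as a parameter. The
  velocity of the circle cancels the factor 1/(2 pi i), which leaves an integral over a fixed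
  interval.\<close>

lemma pd1_Cauchy:
  assumes f: "separately_holomorphic_on f (cball a r \<times> S)" and "r > 0" "x \<in> ball a r" "y \<in> S"
  shows "pd1 f (x, y) = integral (cbox 0 1)
    (\<lambda>t. r * exp (2 * of_real pi * \<i> * of_real t) * f (circlepath a r t, y) / (circlepath a r t - x)\<^sup>2)"
proof -
  have cont: "continuous_on (cball a r) (\<lambda>w. f (w, y))"
    using f \<open>y \<in> S\<close> unfolding separately_holomorphic_on_def
    by (auto intro!: continuous_on_compose2[of "cball a r \<times> S" f] continuous_intros)
  have "(\<lambda>w. f (w, y)) holomorphic_on cball a r"
    using f \<open>y \<in> S\<close> unfolding separately_holomorphic_on_def holomorphic_on_def
    by (fastforce intro: field_differentiable_at_within)
  then have hol: "(\<lambda>w. f (w, y)) holomorphic_on ball a r"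
    by (rule holomorphic_on_subset) auto
  have "pd1 f (x, y) = 1 / (2 * of_real pi * \<i>) * contour_integral (circlepath a r) (\<lambda>u. f (u, y) / (u - x)\<^sup>2)"
    using DERIV_imp_deriv[OF Cauchy_derivative_integral_circlepath(2)[OF cont hol \<open>x \<in> ball a r\<close>]]
    by (simp add: pd1_def)
  also have "\<dots> = integral {0..1} (\<lambda>t. 1 / (2 * of_real pi * \<i>) *
      (f (circlepath a r t, y) / (circlepath a r t - x)\<^sup>2 * vector_derivative (circlepath a r) (at t)))"
    by (simp only: contour_integral_integral integral_mult_right)
  also have "\<dots> = integral {0..1} (\<lambda>t. r * exp (2 * of_real pi * \<i> * of_real t) *
      f (circlepath a r t, y) / (circlepath a r t - x)\<^sup>2)"
    by (simp add: vector_derivative_circlepath mult_ac)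
  finally show ?thesis by simp
qed

lemma circlepath_in_sphere: "r \<ge> 0 \<Longrightarrow> dist a (circlepath a r t) = r"
  by (simp add: circlepath dist_norm norm_mult)

lemma continuous_on_circlepath [continuous_intros]:
  assumes "continuous_on S g"
  shows "continuous_on S (\<lambda>x. circlepath a r (g x))"
  unfolding circlepath by (intro continuous_intros assms)

text \<open>The denominator cannot vanish: the circle has distance exactly \<open>r\<close> from
  \<open>a\<close>, while \<open>fst z\<close> lies strictly inside.\<close>

lemma continuous_on_Cauchy_kernel:
  assumes "continuous_on (cball a r \<times> S) f" "r > 0"
  shows "continuous_on ((ball a r \<times> S) \<times> T) (\<lambda>(z, t). r * exp (2 * of_real pi * \<i> * of_real t) *
      f (circlepath a r t, snd z) / (circlepath a r t - fst z)\<^sup>2 :: complex)"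
proof -
  have "circlepath a r t \<noteq> x" if "x \<in> ball a r" for x t
    using circlepath_in_sphere[of r a t] that \<open>r > 0\<close> by auto
  moreover have "circlepath a r t \<in> cball a r" for t
    using circlepath_in_sphere[of r a t] \<open>r > 0\<close> by auto
  ultimately show ?thesis
    by (auto simp: case_prod_unfold intro!: continuous_intros continuous_on_compose2[OF assms(1)])
qed

lemma continuous_on_pd1_polydisc:
  assumes "separately_holomorphic_on f (cball a r \<times> S)" "r > 0"
  shows "continuous_on (ball a r \<times> S) (pd1 f)"
proof -
  have "continuous_on (ball a r \<times> S) (\<lambda>z. integral (cbox 0 1)
    (\<lambda>t. r * exp (2 * of_real pi * \<i> * of_real t) * f (circlepath a r t, snd z) / (circlepath a r t - fst z)\<^sup>2))"
    using assms
    by (intro integral_continuous_on_param continuous_on_Cauchy_kernel)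
       (auto simp: separately_holomorphic_on_def)
  then show ?thesis
    by (rule continuous_on_eq) (use pd1_Cauchy[OF assms] in \<open>auto\<close>)
qed

lemma continuous_on_pd1:
  assumes "separately_holomorphic_on f U" "open U"
  shows "continuous_on U (pd1 f)"
proof (rule continuous_at_imp_continuous_on, rule ballI)
  fix z assume "z \<in> U"
  then obtain r where r: "r > 0" "cball (fst z) r \<times> cball (snd z) r \<subseteq> U"
    using open_contains_polydisc[of U "fst z" "snd z"] assms(2) by auto
  have "continuous_on (ball (fst z) r \<times> ball (snd z) r) (pd1 f)"
    by (rule continuous_on_pd1_polydisc)
       (use r in \<open>auto intro!: separately_holomorphic_subset[OF assms(1)]\<close>)
  moreover have "open (ball (fst z) r \<times> ball (snd z) r)" "z \<in> ball (fst z) r \<times> ball (snd z) r"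
    using r(1) by (auto simp: open_Times mem_Times_iff)
  ultimately show "isCont (pd1 f) z"
    using continuous_on_eq_continuous_at by blast
qed

lemma continuous_on_pd2:
  assumes "separately_holomorphic_on f U" "open U"
  shows "continuous_on U (pd2 f)"
proof -
  have "continuous_on (prod.swap -` U) (pd1 (f \<circ> prod.swap))"
    by (intro continuous_on_pd1 separately_holomorphic_swap open_swap_vimage assms)
  then have "continuous_on U (\<lambda>z. pd1 (f \<circ> prod.swap) (prod.swap z))"
    by (rule continuous_on_compose2) (auto simp: prod.swap_def intro!: continuous_intros)
  then show ?thesis by (simp add: pd1_swap)
qed

text \<open>Differentiation under the integral: only the factor \<open>f\<close> of the integrand
  depends on the second variable. The result is itself a Cauchy integral, that of
  \<open>pd2 f\<close>, which later yields the symmetry of the mixed derivatives.\<close>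

lemma pd1_has_pd2_integral:
  assumes f: "separately_holomorphic_on f U" and "open U" and r: "r > 0" "cball a r \<times> cball b r \<subseteq> U"
    and x: "x \<in> ball a r" and y: "y \<in> ball b r"
  shows "((\<lambda>w. pd1 f (x, w)) has_field_derivative integral (cbox 0 1)
    (\<lambda>t. r * exp (2 * of_real pi * \<i> * of_real t) * pd2 f (circlepath a r t, y) / (circlepath a r t - x)\<^sup>2)) (at y)"
proof -
  have f': "separately_holomorphic_on f (cball a r \<times> ball b r)"
    by (rule separately_holomorphic_subset[OF f]) (use r in auto)
  have circ: "(circlepath a r t, w) \<in> U" if "w \<in> ball b r" for t w
    using that r circlepath_in_sphere[of r a t] by (auto simp: subset_iff)
  \<comment> \<open>General in \<open>g\<close> because Leibniz' rule needs it twice: for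
    \<open>f\<close>, to integrate, and for \<open>pd2 f\<close>, as continuity of the
    derivative.\<close>
  have Q: "continuous_on (ball b r \<times> cbox 0 1) (\<lambda>(w, t). r * exp (2 * of_real pi * \<i> * of_real t) *
      g (circlepath a r t, w) / (circlepath a r t - x)\<^sup>2 :: complex)"
    if "continuous_on (cball a r \<times> ball b r) g" for g
  proof -
    have "continuous_on (ball b r \<times> cbox 0 1) (\<lambda>p. (\<lambda>(z, t). r * exp (2 * of_real pi * \<i> * of_real t) *
      g (circlepath a r t, snd z) / (circlepath a r t - fst z)\<^sup>2 :: complex) ((x, fst p), snd p))"
      by (rule continuous_on_compose2[OF continuous_on_Cauchy_kernel[OF that r(1), of "cbox 0 1"]])
         (use x in \<open>auto intro!: continuous_intros\<close>)
    then show ?thesis by (simp add: case_prod_unfold)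
  qed
  have "((\<lambda>w. integral (cbox 0 1) (\<lambda>t. r * exp (2 * of_real pi * \<i> * of_real t) *
      f (circlepath a r t, w) / (circlepath a r t - x)\<^sup>2)) has_field_derivative integral (cbox 0 1)
    (\<lambda>t. r * exp (2 * of_real pi * \<i> * of_real t) * pd2 f (circlepath a r t, y) / (circlepath a r t - x)\<^sup>2))
    (at y within ball b r)"
  proof (rule leibniz_rule_field_derivative[where
        f = "\<lambda>w t. r * exp (2 * of_real pi * \<i> * of_real t) * f (circlepath a r t, w) / (circlepath a r t - x)\<^sup>2" and
        fx = "\<lambda>w t. r * exp (2 * of_real pi * \<i> * of_real t) * pd2 f (circlepath a r t, w) / (circlepath a r t - x)\<^sup>2"])
    fix w t assume w: "w \<in> ball b r"
    have "((\<lambda>w. f (circlepath a r t, w)) has_field_derivative pd2 f (circlepath a r t, w)) (at w within ball b r)"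
      by (rule has_field_derivative_at_within[OF separately_holomorphic_has_pd(2)[OF f circ[OF w]]])
    then show "((\<lambda>w. r * exp (2 * of_real pi * \<i> * of_real t) *
      f (circlepath a r t, w) / (circlepath a r t - x)\<^sup>2) has_field_derivative
       r * exp (2 * of_real pi * \<i> * of_real t) * pd2 f (circlepath a r t, w) / (circlepath a r t - x)\<^sup>2)
       (at w within ball b r)"
      by (intro DERIV_cdivide DERIV_cmult)
  next
    fix w assume w: "w \<in> ball b r"
    have "continuous_on (cball a r \<times> ball b r) f"
      using f' by (simp add: separately_holomorphic_on_def)
    moreover have "continuous_on (cbox (0::real) 1) (Pair w)" "Pair w ` cbox 0 1 \<subseteq> ball b r \<times> cbox (0::real) 1"
      using w by (auto intro!: continuous_intros)
    ultimately have "continuous_on (cbox 0 1) (\<lambda>t. r * exp (2 * of_real pi * \<i> * of_real t) *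
      f (circlepath a r t, w) / (circlepath a r t - x)\<^sup>2)"
      using continuous_on_compose2[OF Q, of f "cbox 0 1" "Pair w"] by simp
    then show "(\<lambda>t. r * exp (2 * of_real pi * \<i> * of_real t) *
      f (circlepath a r t, w) / (circlepath a r t - x)\<^sup>2) integrable_on cbox 0 1"
      by (rule integrable_continuous)
  next
    show "continuous_on (ball b r \<times> cbox 0 1) (\<lambda>(w, t). r * exp (2 * of_real pi * \<i> * of_real t) *
      pd2 f (circlepath a r t, w) / (circlepath a r t - x)\<^sup>2)"
      by (rule Q, rule continuous_on_subset[OF continuous_on_pd2[OF f \<open>open U\<close>]]) (use r in auto)
  qed (use y in auto)
  then have "((\<lambda>w. pd1 f (x, w)) has_field_derivative integral (cbox 0 1)
    (\<lambda>t. r * exp (2 * of_real pi * \<i> * of_real t) * pd2 f (circlepath a r t, y) / (circlepath a r t - x)\<^sup>2))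
    (at y within ball b r)"
    by (rule has_field_derivative_transform_within[OF _ zero_less_one]) (use pd1_Cauchy[OF f' r(1) x] y in auto)
  then show ?thesis
    using y by (simp add: at_within_open[of y "ball b r"])
qed

text \<open>In the first variable the derivative of a holomorphic function is holomorphic; in the
  second the differentiated Cauchy integral supplies the derivative.\<close>

lemma separately_holomorphic_pd1:
  assumes f: "separately_holomorphic_on f U" and "open U"
  shows "separately_holomorphic_on (pd1 f) U"
  unfolding separately_holomorphic_on_def
proof (intro conjI ballI continuous_on_pd1 assms)
  fix z assume "z \<in> U"
  then obtain r where r: "r > 0" "cball (fst z) r \<times> cball (snd z) r \<subseteq> U"
    using open_contains_polydisc[of U "fst z" "snd z"] assms(2) by auto
  have "(\<lambda>w. f (w, snd z)) holomorphic_on ball (fst z) r"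
    unfolding holomorphic_on_def
  proof
    fix w assume "w \<in> ball (fst z) r"
    then have "(w, snd z) \<in> U" using r by (auto simp: subset_iff)
    then show "(\<lambda>w. f (w, snd z)) field_differentiable at w within ball (fst z) r"
      using f by (fastforce simp: separately_holomorphic_on_def intro: field_differentiable_at_within)
  qed
  then have "deriv (\<lambda>w. f (w, snd z)) holomorphic_on ball (fst z) r"
    by (rule holomorphic_deriv) simp
  then show "(\<lambda>w. pd1 f (w, snd z)) field_differentiable at (fst z)"
    using r by (simp add: pd1_def holomorphic_on_imp_differentiable_at)
  show "(\<lambda>w. pd1 f (fst z, w)) field_differentiable at (snd z)"
    using pd1_has_pd2_integral[OF assms r, of "fst z" "snd z"] r(1)
    by (auto simp: field_differentiable_def)
qed

lemma separately_holomorphic_pd2: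
  assumes f: "separately_holomorphic_on f U" and "open U"
  shows "separately_holomorphic_on (pd2 f) U"
proof -
  have "separately_holomorphic_on (pd1 (f \<circ> prod.swap) \<circ> prod.swap) (prod.swap -` (prod.swap -` U))"
    by (intro separately_holomorphic_swap separately_holomorphic_pd1 open_swap_vimage assms)
  moreover have "pd1 (f \<circ> prod.swap) \<circ> prod.swap = pd2 f"
    by (auto simp: fun_eq_iff pd1_swap)
  moreover have "prod.swap -` (prod.swap -` U) = U"
    by auto
  ultimately show ?thesis by simp
qed

text \<open>Both sides are the same integral: one by differentiating the Cauchy integral of
  \<open>pd1 f\<close> in the second variable, the other by Cauchy's formula for
  \<open>pd2 f\<close>.\<close>

lemma pd_commute:
  assumes f: "separately_holomorphic_on f U" and "open U" "z \<in> U"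
  shows "pd2 (pd1 f) z = pd1 (pd2 f) z"
proof -
  obtain r where r: "r > 0" "cball (fst z) r \<times> cball (snd z) r \<subseteq> U"
    using open_contains_polydisc[of U "fst z" "snd z"] assms(2,3) by auto
  have "separately_holomorphic_on (pd2 f) (cball (fst z) r \<times> cball (snd z) r)"
    by (rule separately_holomorphic_subset[OF separately_holomorphic_pd2 r(2)]) fact+
  from pd1_Cauchy[OF this r(1), of "fst z" "snd z"]
       DERIV_imp_deriv[OF pd1_has_pd2_integral[OF assms(1,2) r, of "fst z" "snd z"]] r(1)
  show ?thesis
    by (simp add: pd2_def[of "pd1 f"])
qed

text \<open>Both partial derivatives exist and \<open>pd2 f\<close> is continuous, which is enough
  for total differentiability.\<close>

lemma separately_holomorphic_has_derivative:
  assumes f: "separately_holomorphic_on f U" and "open U" "z \<in> U"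
  shows "(f has_derivative (\<lambda>h. pd1 f z * fst h + pd2 f z * snd h)) (at z)"
proof -
  obtain a b where z: "z = (a, b)" by fastforce
  obtain r where r: "r > 0" "cball a r \<times> cball b r \<subseteq> U"
    using open_contains_polydisc[of U a b] assms(2,3) z by auto
  have sub: "ball a r \<times> ball b r \<subseteq> U"
    using r(2) ball_subset_cball by blast
  have "((\<lambda>(x, y). f (x, y)) has_derivative
      (\<lambda>(tx, ty). pd1 f (a, b) * tx + blinfun_mult_right (pd2 f (a, b)) ty)) (at (a, b) within ball a r \<times> ball b r)"
  proof (rule has_derivative_partialsI)
    show "((\<lambda>x. f (x, b)) has_derivative (*) (pd1 f (a, b))) (at a within ball a r)"
      using separately_holomorphic_has_pd(1)[OF f, of a b] assms(3) z
      by (auto simp: has_field_derivative_def intro: has_derivative_at_withinI)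
    show "((\<lambda>y. f (x, y)) has_derivative blinfun_mult_right (pd2 f (x, y))) (at y within ball b r)"
      if "x \<in> ball a r" "y \<in> ball b r" for x y
      using separately_holomorphic_has_pd(2)[OF f, of x y] sub that
      by (auto simp: has_field_derivative_def subset_iff intro!: has_derivative_at_withinI)
    have "isCont (pd2 f) (a, b)"
      using continuous_on_pd2[OF f \<open>open U\<close>] assms(2,3) z by (simp add: continuous_on_eq_continuous_at)
    then have "isCont (\<lambda>p. blinfun_mult_right (pd2 f p)) (a, b)"
      by (intro bounded_linear.isCont[OF bounded_linear_blinfun_mult_right])
    then show "continuous (at (a, b) within ball a r \<times> ball b r) (\<lambda>(x, y). blinfun_mult_right (pd2 f (x, y)))"
      by (auto simp: case_prod_unfold intro: continuous_at_imp_continuous_at_within)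
  qed (use r in auto)
  then show ?thesis
    using r(1) by (simp add: z case_prod_unfold at_within_open[of "(a, b)" "ball a r \<times> ball b r"] open_Times)
qed

text \<open>Directional derivatives have this form, with \<open>c\<close> and \<open>d\<close> the
  components of the direction; this closes the induction for \<open>Ck_on\<close>.\<close>

lemma separately_holomorphic_cmult_add:
  assumes "separately_holomorphic_on f U" "separately_holomorphic_on g U"
  shows "separately_holomorphic_on (\<lambda>z. f z * c + g z * d) U"
  using assms unfolding separately_holomorphic_on_def
  by (auto intro!: continuous_intros field_differentiable_add field_differentiable_mult field_differentiable_const)

subsection \<open>Smoothness and shear charts\<close>

lemma Ck_on_cong:
  assumes "open S" "\<And>x. x \<in> S \<Longrightarrow> f x = g x"
  shows "Ck_on k S f \<longleftrightarrow> Ck_on k S g"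
  using assms(2)
proof (induction k arbitrary: f g)
  case 0
  then show ?case by (simp cong: continuous_on_cong)
next
  case (Suc k)
  have eq: "(f has_derivative D) (at x) \<longleftrightarrow> (g has_derivative D) (at x)" if "x \<in> S" for x D
    using has_derivative_transform_within_open[of f D x UNIV S g]
      has_derivative_transform_within_open[of g D x UNIV S f] assms(1) that Suc.prems by auto
  \<comment> \<open>\<open>frechet_derivative\<close> is a choice among derivatives; by
    \<open>eq\<close> both choices are made from the same predicate.\<close>
  then have "frechet_derivative f (at x) = frechet_derivative g (at x)" if "x \<in> S" for x
    using that by (simp add: frechet_derivative_def)
  then have "Ck_on k S (\<lambda>x. frechet_derivative f (at x) v) = Ck_on k S (\<lambda>x. frechet_derivative g (at x) v)" for v
    using Suc.IH[of "\<lambda>x. frechet_derivative f (at x) v" "\<lambda>x. frechet_derivative g (at x) v"] by simp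
  moreover have "f differentiable_on S \<longleftrightarrow> g differentiable_on S"
    using assms(1) eq by (simp add: differentiable_on_eq_differentiable_at differentiable_def)
  ultimately show ?case by simp
qed

text \<open>Lets an explicit derivative \<open>D\<close> replace the chosen
  \<open>frechet_derivative\<close> in the recursion of \<open>Ck_on\<close>.\<close>

lemma Ck_on_SucI:
  assumes "open S" "\<And>x. x \<in> S \<Longrightarrow> (f has_derivative D x) (at x)" "\<And>v. Ck_on k S (\<lambda>x. D x v)"
  shows "Ck_on (Suc k) S f"
proof -
  have "frechet_derivative f (at x) = D x" if "x \<in> S" for x
    using frechet_derivative_at[OF assms(2)[OF that]] by simp
  then have "Ck_on k S (\<lambda>x. frechet_derivative f (at x) v)" for v
    using assms(3)[of v] Ck_on_cong[OF assms(1), of "\<lambda>x. D x v" "\<lambda>x. frechet_derivative f (at x) v" k] by simp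
  moreover have "f differentiable_on S"
    using assms(1,2) by (auto simp: differentiable_on_eq_differentiable_at differentiable_def)
  ultimately show ?thesis by simp
qed

lemma Ck_on_SucD:
  assumes "Ck_on (Suc k) S f" "open S" "x \<in> S"
  shows "(f has_derivative frechet_derivative f (at x)) (at x)"
  using assms by (auto simp: differentiable_on_eq_differentiable_at frechet_derivative_works)

lemma Ck_on_const: "open S \<Longrightarrow> Ck_on k S (\<lambda>x. c)"
  by (induction k arbitrary: c)
     (auto intro!: Ck_on_SucI[where D = "\<lambda>_ _. 0"] derivative_eq_intros simp del: Ck_on.simps(2))

lemma Ck_on_bounded_linear:
  assumes "open S" "bounded_linear A"
  shows "Ck_on k S A"
proof (cases k)
  case 0
  then show ?thesis using assms by (simp add: linear_continuous_on)
next
  case (Suc k')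
  have "Ck_on (Suc k') S A"
    by (rule Ck_on_SucI[where D = "\<lambda>_. A"])
       (use assms in \<open>auto intro: bounded_linear_imp_has_derivative Ck_on_const\<close>)
  then show ?thesis using Suc by simp
qed

lemma Ck_on_add:
  assumes "open S" "Ck_on k S f" "Ck_on k S g"
  shows "Ck_on k S (\<lambda>x. f x + g x)"
  using assms(2,3)
proof (induction k arbitrary: f g)
  case 0
  then show ?case by (simp add: continuous_on_add)
next
  case (Suc k)
  show ?case
    by (rule Ck_on_SucI[where D = "\<lambda>x v. frechet_derivative f (at x) v + frechet_derivative g (at x) v"])
       (use Suc assms(1) in \<open>auto intro!: has_derivative_add Suc.IH Ck_on_SucD[of k S]\<close>)
qed

text \<open>Linear maps on both sides keep the induction closed: the derivative in direction
  \<open>v\<close> is again \<open>A (g (B x))\<close>, with \<open>g\<close> the derivative of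
  \<open>f\<close> in direction \<open>B v\<close>.\<close>

lemma Ck_on_linear_compose:
  fixes B :: "'a::euclidean_space \<Rightarrow> 'b::euclidean_space" and A :: "'c::euclidean_space \<Rightarrow> 'd::euclidean_space"
  assumes "open S" "bounded_linear A" "bounded_linear B" "Ck_on k S f"
  shows "Ck_on k (B -` S) (\<lambda>x. A (f (B x)))"
  using assms(4)
proof (induction k arbitrary: f)
  case 0
  have "continuous_on (B -` S) (\<lambda>x. f (B x))"
    by (rule continuous_on_compose2[of S f]) (use 0 assms in \<open>auto intro: linear_continuous_on\<close>)
  then show ?case
    using bounded_linear.continuous_on[OF assms(2)] by simp
next
  case (Suc k)
  have "open (B -` S)"
    using assms(1,3) by (auto intro: open_vimage linear_continuous_on)
  then show ?case
  proof (rule Ck_on_SucI)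
    show "Ck_on k (B -` S) (\<lambda>x. A (frechet_derivative f (at (B x)) (B v)))" for v
      using Suc by auto
    fix x assume "x \<in> B -` S"
    then have "(f has_derivative frechet_derivative f (at (B x))) (at (B x))"
      using Suc.prems assms(1) by (auto intro: Ck_on_SucD)
    from has_derivative_compose[OF bounded_linear_imp_has_derivative[OF assms(3)] this]
    show "((\<lambda>x. A (f (B x))) has_derivative (\<lambda>v. A (frechet_derivative f (at (B x)) (B v)))) (at x)"
      by (rule bounded_linear.has_derivative[OF assms(2)])
  qed
qed

lemma separately_holomorphic_imp_Ck_on:
  assumes "separately_holomorphic_on f U" "open U"
  shows "Ck_on k U f"
  using assms(1)
proof (induction k arbitrary: f)
  case 0
  then show ?case by (simp add: separately_holomorphic_on_def)
next
  case (Suc k)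
  show ?case
  proof (rule Ck_on_SucI[OF \<open>open U\<close>])
    show "(f has_derivative (\<lambda>v. pd1 f z * fst v + pd2 f z * snd v)) (at z)" if "z \<in> U" for z
      using separately_holomorphic_has_derivative Suc.prems \<open>open U\<close> that .
    show "Ck_on k U (\<lambda>z. pd1 f z * fst v + pd2 f z * snd v)" for v
      by (intro Suc.IH separately_holomorphic_cmult_add separately_holomorphic_pd1
          separately_holomorphic_pd2 Suc.prems \<open>open U\<close>)
  qed
qed

text \<open>By \<open>B0\<close> the shear \<open>x - \<kappa> (B x)\<close> leaves
  \<open>B x\<close> unchanged, so \<open>x + \<kappa> (B x)\<close> inverts it. One chart, on the
  whole preimage of \<open>U\<close>, serves every point.\<close>

lemma shear_preimage_embedded_submanifold:
  fixes B :: "'a::euclidean_space \<Rightarrow> 'b::euclidean_space" and \<kappa> :: "'b \<Rightarrow> 'a"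
  assumes "open U" and B: "bounded_linear B" and B0: "\<And>y. B (\<kappa> y) = 0"
    and smooth: "\<And>k. Ck_on k (B -` U) (\<lambda>x. \<kappa> (B x))"
    and "subspace S" "dim S = d"
  shows "embedded_submanifold d {x. B x \<in> U \<and> x - \<kappa> (B x) \<in> S}" (is "embedded_submanifold d ?L")
  unfolding embedded_submanifold_def
proof (intro ballI exI conjI)
  interpret B: bounded_linear B by (rule B)
  let ?V = "B -` U" and ?h = "\<lambda>x. x - \<kappa> (B x)" and ?h' = "\<lambda>x. x + \<kappa> (B x)"
  have V: "open ?V"
    using assms(1) B by (auto intro: open_vimage linear_continuous_on)
  have neg: "Ck_on k ?V (\<lambda>x. - \<kappa> (B x))" for k
    using Ck_on_linear_compose[OF V bounded_linear_minus[OF bounded_linear_ident] bounded_linear_ident smooth]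
    by simp
  have id: "Ck_on k ?V (\<lambda>x. x)" for k
    by (intro Ck_on_bounded_linear V bounded_linear_ident)
  have h: "smooth_on ?V ?h" and h': "smooth_on ?V ?h'"
    using Ck_on_add[OF V id neg] Ck_on_add[OF V id smooth] by (auto simp: smooth_on_def)
  have "Ck_on 0 ?V ?h" "Ck_on 0 ?V ?h'"
    using h h' unfolding smooth_on_def by blast+
  then have "homeomorphism ?V ?V ?h ?h'"
    by (intro homeomorphismI) (auto simp: B.diff B.add B0)
  then show "diffeomorphism ?V ?V ?h ?h'"
    using V h h' by (simp add: diffeomorphism_def)
  show "?h ` (?L \<inter> ?V) = ?V \<inter> S"
  proof
    show "?V \<inter> S \<subseteq> ?h ` (?L \<inter> ?V)"
    proof
      fix y assume "y \<in> ?V \<inter> S"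
      then have "y = ?h (?h' y)" "?h' y \<in> ?L \<inter> ?V"
        by (auto simp: B.add B0)
      then show "y \<in> ?h ` (?L \<inter> ?V)" by (rule image_eqI)
    qed
  qed (auto simp: B.diff B0)
  fix x assume "x \<in> ?L"
  then show "x \<in> ?V" by simp
qed (use assms in simp_all)

subsection \<open>The linear isomorphism \<open>F\<close>\<close>

text \<open>Laplace expansion along the first two rows. For the coframe matrix, the minors are
  values of the two-forms obtained from the first two and the last two of the forms dq + i
  dp.\<close>

lemma det_4_Laplace:
  fixes A :: "'a::comm_ring_1^4^4"
  defines "m \<equiv> \<lambda>i k j l. A$i$j * A$k$l - A$i$l * A$k$j"
  shows "det A = m 1 2 1 2 * m 3 4 3 4 - m 1 2 1 3 * m 3 4 2 4 + m 1 2 1 4 * m 3 4 2 3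
    + m 1 2 2 3 * m 3 4 1 4 - m 1 2 2 4 * m 3 4 1 3 + m 1 2 3 4 * m 3 4 1 2"
proof -
  have f: "finite {2::4, 3, 4}" "1 \<notin> {2::4, 3, 4}" "finite {3::4, 4}" "2 \<notin> {3::4, 4}"
    "finite {4::4}" "3 \<notin> {4::4}"
    by auto
  show ?thesis
    unfolding det_def UNIV_4 m_def
    unfolding sum_over_permutations_insert[OF f(1,2)]
    unfolding sum_over_permutations_insert[OF f(3,4)]
    unfolding sum_over_permutations_insert[OF f(5,6)]
    unfolding permutes_sing
    by (simp add: sign_swap_id permutation_swap_id permutation_compose sign_compose sign_id swap_id_eq)
       (simp add: algebra_simps)
qed

text \<open>Here \<open>x1 = q1 + (-1 + \<i>) q2\<close> and \<open>y1 = (1 - \<i>) p1 - \<i> p2\<close>, and likewise for the second pair of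
  indices.\<close>

definition F_inv :: "complex \<Rightarrow> complex \<times> complex \<times> complex \<times> complex \<Rightarrow> cotangent4" where
  "F_inv \<alpha> = (\<lambda>(z1, z2, u1, u2). let
       r = of_real (sqrt 2);
       x1 = \<i> * (z1 + u1) / (\<alpha> * r); y1 = \<i> * \<alpha> * (z1 - u1) / r;
       x2 = (z2 + u2) / (\<alpha> * r); y2 = \<alpha> * (u2 - z2) / r
     in
      (\<chi> j. if j = 1 then Re x1 + Im x1 else if j = 2 then Im x1 else if j = 3 then Re x2 + Im x2 else Im x2,
       \<chi> j. if j = 1 then Re y1 else if j = 2 then - Re y1 - Im y1 else if j = 3 then Re y2 else - Re y2 - Im y2))"

text \<open>Complex coordinates for a pair of indices, through which alone \<open>F_map\<close> sees
  \<open>q\<close> and \<open>p\<close>. The real part of the wedge of \<open>q_pair j k\<close> and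
  \<open>p_pair j k\<close> is the part of \<open>Omega\<close> that belongs to \<open>j\<close> and
  \<open>k\<close>.\<close>

definition q_pair :: "4 \<Rightarrow> 4 \<Rightarrow> cotangent4 \<Rightarrow> complex" where
  "q_pair j k v = of_real (dq j v) + (-1 + \<i>) * of_real (dq k v)"

definition p_pair :: "4 \<Rightarrow> 4 \<Rightarrow> cotangent4 \<Rightarrow> complex" where
  "p_pair j k v = (1 - \<i>) * of_real (dp j v) - \<i> * of_real (dp k v)"

lemma q_pair_linear:
  "q_pair j k (v + w) = q_pair j k v + q_pair j k w" "q_pair j k (c *\<^sub>R v) = of_real c * q_pair j k v"
  by (simp_all add: q_pair_def dq_def algebra_simps)

lemma p_pair_linear:
  "p_pair j k (v + w) = p_pair j k v + p_pair j k w" "p_pair j k (c *\<^sub>R v) = of_real c * p_pair j k v"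
  by (simp_all add: p_pair_def dp_def algebra_simps)

lemma F_map_eq:
  "F_map \<alpha> v =
    ((\<alpha> * q_pair 1 2 v + p_pair 1 2 v / \<alpha>) / (\<i> * of_real (sqrt 2)),
     (\<alpha> * q_pair 3 4 v - p_pair 3 4 v / \<alpha>) / of_real (sqrt 2),
     (\<alpha> * q_pair 1 2 v - p_pair 1 2 v / \<alpha>) / (\<i> * of_real (sqrt 2)),
     (\<alpha> * q_pair 3 4 v + p_pair 3 4 v / \<alpha>) / of_real (sqrt 2))"
  by (simp add: F_map_def Let_def case_prod_unfold q_pair_def p_pair_def dq_def dp_def algebra_simps divide_inverse)

lemma linear_F_map: "linear (F_map \<alpha>)"
  by (rule linearI)
     (simp_all add: F_map_eq q_pair_linear p_pair_linear scaleR_conv_of_real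
        add_divide_distrib diff_divide_distrib distrib_left right_diff_distrib)

text \<open>Sums and differences of the \<open>z\<close>- and \<open>u\<close>-components separate
  \<open>X\<close> from \<open>Y\<close>. In the second index pair \<open>Y\<close> enters
  \<open>F_map\<close> with the opposite sign, hence the reversed difference.\<close>

lemma F_map_solve:
  fixes \<alpha> X Y :: complex
  defines "r \<equiv> of_real (sqrt 2)"
  assumes "\<alpha> \<noteq> 0"
  shows "\<i> * ((\<alpha> * X + Y / \<alpha>) / (\<i> * r) + (\<alpha> * X - Y / \<alpha>) / (\<i> * r)) / (\<alpha> * r) = X"
    and "\<i> * \<alpha> * ((\<alpha> * X + Y / \<alpha>) / (\<i> * r) - (\<alpha> * X - Y / \<alpha>) / (\<i> * r)) / r = Y"
    and "((\<alpha> * X - Y / \<alpha>) / r + (\<alpha> * X + Y / \<alpha>) / r) / (\<alpha> * r) = X"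
    and "\<alpha> * ((\<alpha> * X + Y / \<alpha>) / r - (\<alpha> * X - Y / \<alpha>) / r) / r = Y"
proof -
  have r: "r * r = 2" "r * (r * Z) = 2 * Z" "r \<noteq> 0" for Z
    by (auto simp: r_def simp flip: of_real_mult mult.assoc)
  note s = add_divide_distrib[symmetric] diff_divide_distrib[symmetric]
  show "\<i> * ((\<alpha> * X + Y / \<alpha>) / (\<i> * r) + (\<alpha> * X - Y / \<alpha>) / (\<i> * r)) / (\<alpha> * r) = X"
    unfolding s using \<open>\<alpha> \<noteq> 0\<close> r by (simp add: divide_simps mult_ac)
  show "\<i> * \<alpha> * ((\<alpha> * X + Y / \<alpha>) / (\<i> * r) - (\<alpha> * X - Y / \<alpha>) / (\<i> * r)) / r = Y"
    unfolding s using \<open>\<alpha> \<noteq> 0\<close> r by (simp add: divide_simps mult_ac)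
  show "((\<alpha> * X - Y / \<alpha>) / r + (\<alpha> * X + Y / \<alpha>) / r) / (\<alpha> * r) = X"
    unfolding s using \<open>\<alpha> \<noteq> 0\<close> r by (simp add: divide_simps mult_ac)
  show "\<alpha> * ((\<alpha> * X + Y / \<alpha>) / r - (\<alpha> * X - Y / \<alpha>) / r) / r = Y"
    unfolding s using \<open>\<alpha> \<noteq> 0\<close> r by (simp add: divide_simps mult_ac)
qed

lemma F_map_coords:
  assumes "\<alpha> \<noteq> 0" "F_map \<alpha> v = (z1, z2, u1, u2)"
  shows "\<i> * (z1 + u1) / (\<alpha> * of_real (sqrt 2)) = q_pair 1 2 v"
    and "\<i> * \<alpha> * (z1 - u1) / of_real (sqrt 2) = p_pair 1 2 v"
    and "(z2 + u2) / (\<alpha> * of_real (sqrt 2)) = q_pair 3 4 v"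
    and "\<alpha> * (u2 - z2) / of_real (sqrt 2) = p_pair 3 4 v"
  using F_map_solve[OF assms(1)] assms(2) unfolding F_map_eq by blast+

lemma F_inv_F_map:
  assumes "\<alpha> \<noteq> 0"
  shows "F_inv \<alpha> (F_map \<alpha> v) = v"
proof -
  obtain z1 z2 u1 u2 where F: "F_map \<alpha> v = (z1, z2, u1, u2)" by (metis prod.collapse)
  show ?thesis
    unfolding F F_inv_def Let_def case_prod_conv F_map_coords[OF assms F]
    by (simp add: prod_eq_iff vec_eq_iff forall_4 q_pair_def p_pair_def dq_def dp_def)
qed

lemma F_map_F_inv:
  assumes "\<alpha> \<noteq> 0"
  shows "F_map \<alpha> (F_inv \<alpha> w) = w"
proof -
  define r where "r = complex_of_real (sqrt 2)"
  have r: "r * r = 2" "r * (r * Z) = 2 * Z" "r \<noteq> 0" for Z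
    by (auto simp: r_def simp flip: of_real_mult mult.assoc)
  obtain z1 z2 u1 u2 where w: "w = (z1, z2, u1, u2)" by (metis prod.collapse)
  have "q_pair 1 2 (F_inv \<alpha> w) = \<i> * (z1 + u1) / (\<alpha> * r)"
       "p_pair 1 2 (F_inv \<alpha> w) = \<i> * \<alpha> * (z1 - u1) / r"
       "q_pair 3 4 (F_inv \<alpha> w) = (z2 + u2) / (\<alpha> * r)"
       "p_pair 3 4 (F_inv \<alpha> w) = \<alpha> * (u2 - z2) / r"
    unfolding w F_inv_def Let_def case_prod_conv r_def[symmetric] q_pair_def p_pair_def dq_def dp_def fst_conv snd_conv vec_lambda_beta
    by (simp_all only: complex_eq_iff, simp_all del: of_real_mult)
  then show ?thesis
    using assms r by (simp add: F_map_eq w r_def[symmetric] add_divide_distrib[symmetric] diff_divide_distrib[symmetric])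
       (simp add: field_simps)
qed

lemma linear_F_inv:
  assumes "\<alpha> \<noteq> 0"
  shows "linear (F_inv \<alpha>)"
proof (rule linearI)
  note F = linear_F_map[of \<alpha>]
  show "F_inv \<alpha> (x + y) = F_inv \<alpha> x + F_inv \<alpha> y" for x y
    using F_inv_F_map[OF assms, of "F_inv \<alpha> x + F_inv \<alpha> y"]
    by (simp add: linear_add[OF F] F_map_F_inv[OF assms])
  show "F_inv \<alpha> (c *\<^sub>R x) = c *\<^sub>R F_inv \<alpha> x" for c x
    using F_inv_F_map[OF assms, of "c *\<^sub>R F_inv \<alpha> x"]
    by (simp add: linear_scale[OF F] F_map_F_inv[OF assms])
qed

text \<open>In each index pair the wedge of the \<open>z\<close>- and \<open>u\<close>-components
  equals that of \<open>q_pair\<close> and \<open>p_pair\<close>: the factors -1/2 and 1/2 from the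
  denominators match the opposite signs of \<open>p_pair\<close>. Taking real parts then gives
  \<open>Omega\<close>.\<close>

lemma Omega_F_map:
  assumes "\<alpha> \<noteq> 0" "F_map \<alpha> v = (z1, z2, u1, u2)" "F_map \<alpha> w = (z1', z2', u1', u2')"
  shows "Omega v w = Re (z1 * u1' - z1' * u1 + (z2 * u2' - z2' * u2))"
proof -
  define r where "r = complex_of_real (sqrt 2)"
  have r: "r * r = 2" "r \<noteq> 0"
    by (auto simp: r_def simp flip: of_real_mult)
  have quot: "P / s * (Q / s) - P' / s * (Q' / s) = (P * Q - P' * Q') / (s * s)" for P Q P' Q' s :: complex
    by (simp add: diff_divide_distrib)
  have ir: "\<i> * r * (\<i> * r) = -2"
    using r by (simp add: mult_ac)
  have wedge1: "(\<alpha> * X + Y / \<alpha>) / (\<i> * r) * ((\<alpha> * X' - Y' / \<alpha>) / (\<i> * r))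
      - (\<alpha> * X' + Y' / \<alpha>) / (\<i> * r) * ((\<alpha> * X - Y / \<alpha>) / (\<i> * r)) = X * Y' - X' * Y" for X Y X' Y'
    unfolding quot ir using assms(1) by (simp add: field_simps)
  have wedge2: "(\<alpha> * X - Y / \<alpha>) / r * ((\<alpha> * X' + Y' / \<alpha>) / r)
      - (\<alpha> * X' - Y' / \<alpha>) / r * ((\<alpha> * X + Y / \<alpha>) / r) = X * Y' - X' * Y" for X Y X' Y'
    unfolding quot r(1) using assms(1) by (simp add: field_simps)
  have "z1 * u1' - z1' * u1 + (z2 * u2' - z2' * u2)
      = q_pair 1 2 v * p_pair 1 2 w - q_pair 1 2 w * p_pair 1 2 v
        + (q_pair 3 4 v * p_pair 3 4 w - q_pair 3 4 w * p_pair 3 4 v)"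
    using assms(2,3) wedge1 wedge2 unfolding F_map_eq r_def[symmetric] by (metis prod.inject)
  then show ?thesis
    by (simp only:) (simp add: Omega_def sum_4 q_pair_def p_pair_def algebra_simps)
qed

subsection \<open>The special Lagrangian form on graph tangent spaces\<close>

text \<open>Here \<open>X\<close>, \<open>Y\<close> stand for the values of \<open>q_pair j k\<close>, \<open>p_pair j k\<close> and \<open>X'\<close>, \<open>Y'\<close> for their
  conjugates; \<open>e\<close> and \<open>f\<close> are then \<open>dq j + \<i> dp j\<close> and \<open>dq k + \<i> dp k\<close>. Conjugates are kept as independent
  variables so that the identities are polynomial.\<close>

lemma coframe_minor:
  fixes X X' Y Y' P P' Q Q' :: complex
  defines "e \<equiv> \<lambda>X X' Y Y'. 1/2 * ((1 - \<i>) * X + (1 + \<i>) * X' + \<i> * (Y + Y'))"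
    and "f \<equiv> \<lambda>X X' Y Y'. -1/2 * \<i> * (X - X' + (1 - \<i>) * Y + (1 + \<i>) * Y')"
  shows "e X X' Y Y' * f P P' Q Q' - e P P' Q Q' * f X X' Y Y' =
    1/2 * \<i> * ((X * P' - P * X') + (Y * Q' - Q * Y')) - 3/4 * ((X * Q - P * Y) - (X' * Q' - P' * Y'))
    - 1/4 * (1 + 2 * \<i>) * (X * Q' - P * Y') + 1/4 * (1 - 2 * \<i>) * (X' * Q - P' * Y)"
  unfolding e_def f_def by (simp add: field_simps)

text \<open>\<open>coframe_minor\<close> in the coordinates of \<open>F_map\<close>, meant for
  \<open>\<beta>\<close> the conjugate of \<open>\<alpha>\<close>, \<open>\<kappa>\<close> = 1/sqrt
  2 and \<open>s\<close> = sqrt 5. The value of \<open>\<alpha>\<^sup>2\<close> makes both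
  coefficients of the last two terms equal to \<open>s\<close> up to sign, so the mixed products of
  \<open>z\<close> with \<open>u'\<close> and of \<open>u\<close> with \<open>z'\<close>
  cancel.\<close>

lemma coframe_minor_graph:
  fixes z z' u u' w w' t t' \<alpha> \<beta> \<kappa> s \<epsilon> :: complex
  defines "e \<equiv> \<lambda>X X' Y Y'. 1/2 * ((1 - \<i>) * X + (1 + \<i>) * X' + \<i> * (Y + Y'))"
    and "f \<equiv> \<lambda>X X' Y Y'. -1/2 * \<i> * (X - X' + (1 - \<i>) * Y + (1 + \<i>) * Y')"
  assumes "\<alpha> * \<beta> = 1" "s * \<alpha>\<^sup>2 = 1 + 2 * \<i>" "s * \<beta>\<^sup>2 = 1 - 2 * \<i>" "s * s = 5" "2 * \<kappa>\<^sup>2 = 1"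
  shows "e (\<i> * \<beta> * \<kappa> * (z + u)) (- \<i> * \<alpha> * \<kappa> * (z' + u')) (\<i> * \<alpha> * \<kappa> * (z - u)) (- \<i> * \<beta> * \<kappa> * (z' - u')) *
     f (\<i> * \<beta> * \<kappa> * (w + t)) (- \<i> * \<alpha> * \<kappa> * (w' + t')) (\<i> * \<alpha> * \<kappa> * (w - t)) (- \<i> * \<beta> * \<kappa> * (w' - t')) -
     e (\<i> * \<beta> * \<kappa> * (w + t)) (- \<i> * \<alpha> * \<kappa> * (w' + t')) (\<i> * \<alpha> * \<kappa> * (w - t)) (- \<i> * \<beta> * \<kappa> * (w' - t')) *
     f (\<i> * \<beta> * \<kappa> * (z + u)) (- \<i> * \<alpha> * \<kappa> * (z' + u')) (\<i> * \<alpha> * \<kappa> * (z - u)) (- \<i> * \<beta> * \<kappa> * (z' - u')) =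
    1/2 * \<i> * ((z * w' - w * z') + (u * t' - t * u')) - 3/4 * ((z * t - w * u) - (z' * t' - w' * u'))
    - 1/4 * s * ((z * w' - w * z') - (u * t' - t * u'))" (is "?L1 = ?R1")
   and "e (\<beta> * \<kappa> * (z + u)) (\<alpha> * \<kappa> * (z' + u')) (\<alpha> * \<kappa> * (u - z)) (\<beta> * \<kappa> * (u' - z')) *
     f (\<beta> * \<kappa> * (w + t)) (\<alpha> * \<kappa> * (w' + t')) (\<alpha> * \<kappa> * (t - w)) (\<beta> * \<kappa> * (t' - w')) -
     e (\<beta> * \<kappa> * (w + t)) (\<alpha> * \<kappa> * (w' + t')) (\<alpha> * \<kappa> * (t - w)) (\<beta> * \<kappa> * (t' - w')) *
     f (\<beta> * \<kappa> * (z + u)) (\<alpha> * \<kappa> * (z' + u')) (\<alpha> * \<kappa> * (u - z)) (\<beta> * \<kappa> * (u' - z')) =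
    1/2 * \<i> * ((z * w' - w * z') + (u * t' - t * u')) - 3/4 * ((z * t - w * u) - (z' * t' - w' * u'))
    + 1/4 * s * ((z * w' - w * z') - (u * t' - t * u'))" (is "?L2 = ?R2")
proof -
  have \<beta>: "(1 + 2 * \<i>) * \<beta>\<^sup>2 = s" and \<alpha>: "(1 - 2 * \<i>) * \<alpha>\<^sup>2 = s"
    using assms(3-6) by algebra+
  have "?L1 = 1/2 * \<i> * (\<alpha> * \<beta> * \<kappa>\<^sup>2 * ((z + u) * (w' + t') - (w + t) * (z' + u') + (z - u) * (w' - t') - (w - t) * (z' - u')))
    - 3/4 * (\<alpha> * \<beta> * \<kappa>\<^sup>2 * (- ((z + u) * (w - t) - (w + t) * (z - u)) + ((z' + u') * (w' - t') - (w' + t') * (z' - u'))))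
    - 1/4 * ((1 + 2 * \<i>) * \<beta>\<^sup>2 * \<kappa>\<^sup>2 * ((z + u) * (w' - t') - (w + t) * (z' - u')))
    + 1/4 * ((1 - 2 * \<i>) * \<alpha>\<^sup>2 * \<kappa>\<^sup>2 * ((z' + u') * (w - t) - (w' + t') * (z - u)))"
    unfolding e_def f_def coframe_minor power2_eq_square by (simp add: algebra_simps)
  also have "\<dots> = ?R1"
    unfolding \<alpha> \<beta> assms(3) using assms(7) by algebra
  finally show "?L1 = ?R1" .
  have "?L2 = 1/2 * \<i> * (\<alpha> * \<beta> * \<kappa>\<^sup>2 * ((z + u) * (w' + t') - (w + t) * (z' + u') + (u - z) * (t' - w') - (t - w) * (u' - z')))
    - 3/4 * (\<alpha> * \<beta> * \<kappa>\<^sup>2 * (((z + u) * (t - w) - (w + t) * (u - z)) - ((z' + u') * (t' - w') - (w' + t') * (u' - z'))))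
    - 1/4 * ((1 + 2 * \<i>) * \<beta>\<^sup>2 * \<kappa>\<^sup>2 * ((z + u) * (t' - w') - (w + t) * (u' - z')))
    + 1/4 * ((1 - 2 * \<i>) * \<alpha>\<^sup>2 * \<kappa>\<^sup>2 * ((z' + u') * (t - w) - (w' + t') * (u - z)))"
    unfolding e_def f_def coframe_minor power2_eq_square by (simp add: algebra_simps)
  also have "\<dots> = ?R2"
    unfolding \<alpha> \<beta> assms(3) using assms(7) by algebra
  finally show "?L2 = ?R2" .
qed


text \<open>Here \<open>a\<close>, \<open>b\<close>, \<open>c\<close> are the entries of a symmetric
  Hessian and the \<open>v j\<close> are tangent to the graph. The coframe matrix factors through
  \<open>\<zeta>\<close>, \<open>\<eta>\<close> and their conjugates, and both factors have real
  determinant.\<close>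

lemma omega_SLAG_eq_0:
  fixes \<alpha> a b c :: complex and \<zeta> \<eta> :: "4 \<Rightarrow> complex" and v :: "4 \<Rightarrow> cotangent4"
  assumes \<alpha>2: "\<alpha>\<^sup>2 = (1 + 2 * \<i>) / of_real (sqrt 5)" and ac: "cmod a = cmod c"
    and v: "\<And>j. F_map \<alpha> (v j) = (\<zeta> j, \<eta> j, a * \<zeta> j + b * \<eta> j, b * \<zeta> j + c * \<eta> j)"
  shows "omega_SLAG v = 0"
proof -
  define s \<beta> \<kappa> where "s = complex_of_real (sqrt 5)" and "\<beta> = cnj \<alpha>" and "\<kappa> = complex_of_real (1 / sqrt 2)"
  have s: "s * s = 5" "s \<noteq> 0" "cnj s = s"
    by (auto simp: s_def simp flip: of_real_mult)
  have \<kappa>: "2 * \<kappa>\<^sup>2 = 1" "cnj \<kappa> = \<kappa>"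
    by (auto simp: \<kappa>_def power2_eq_square simp flip: of_real_mult)
  have s\<alpha>: "s * \<alpha>\<^sup>2 = 1 + 2 * \<i>"
    using s(2) by (simp add: \<alpha>2 s_def)
  then have "cnj (s * \<alpha>\<^sup>2) = cnj (1 + 2 * \<i>)"
    by simp
  then have s\<beta>: "s * \<beta>\<^sup>2 = 1 - 2 * \<i>"
    using s(3) by (simp add: \<beta>_def)
  have "(cmod \<alpha>)\<^sup>2 = cmod (\<alpha>\<^sup>2)"
    by (simp add: norm_power)
  also have "\<dots> = 1"
    by (simp add: \<alpha>2 norm_divide) (simp add: cmod_def)
  finally have \<alpha>\<beta>: "\<alpha> * \<beta> = 1"
    by (simp add: \<beta>_def complex_norm_square[symmetric])
  then have \<alpha>0: "\<alpha> \<noteq> 0" and inv\<alpha>: "inverse \<alpha> = \<beta>"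
    by (auto simp: inverse_unique)
  define e where "e = (\<lambda>X X' Y Y'. 1/2 * ((1 - \<i>) * X + (1 + \<i>) * X' + \<i> * (Y + Y')))"
  define f where "f = (\<lambda>X X' Y Y'. -1/2 * \<i> * (X - X' + (1 - \<i>) * Y + (1 + \<i>) * Y'))"
  \<comment> \<open>\<open>A1\<close> and \<open>A2\<close> evaluate a coframe form for the first
    and the second index pair, given the \<open>z\<close>- and \<open>u\<close>-components and their
    conjugates.\<close>
  define A1 where "A1 = (\<lambda>g z z' u u'. g (\<i> * \<beta> * \<kappa> * (z + u)) (- \<i> * \<alpha> * \<kappa> * (z' + u')) (\<i> * \<alpha> * \<kappa> * (z - u)) (- \<i> * \<beta> * \<kappa> * (z' - u')) :: complex)"
  define A2 where "A2 = (\<lambda>g z z' u u'. g (\<beta> * \<kappa> * (z + u)) (\<alpha> * \<kappa> * (z' + u')) (\<alpha> * \<kappa> * (u - z)) (\<beta> * \<kappa> * (u' - z')) :: complex)"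
  note minor = coframe_minor_graph[OF \<alpha>\<beta> s\<alpha> s\<beta> s(1) \<kappa>(1)]
  have minor1: "A1 e z z' u u' * A1 f w w' t t' - A1 e w w' t t' * A1 f z z' u u' =
      1/2 * \<i> * ((z * w' - w * z') + (u * t' - t * u')) - 3/4 * ((z * t - w * u) - (z' * t' - w' * u'))
      - 1/4 * s * ((z * w' - w * z') - (u * t' - t * u'))" for z z' u u' w w' t t'
    unfolding A1_def e_def f_def by (rule minor(1))
  have minor2: "A2 e z z' u u' * A2 f w w' t t' - A2 e w w' t t' * A2 f z z' u u' =
      1/2 * \<i> * ((z * w' - w * z') + (u * t' - t * u')) - 3/4 * ((z * t - w * u) - (z' * t' - w' * u'))
      + 1/4 * s * ((z * w' - w * z') - (u * t' - t * u'))" for z z' u u' w w' t t'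
    unfolding A2_def e_def f_def by (rule minor(2))
  \<comment> \<open>\<open>M\<close> expresses the coframe on the tangent space in the basis of forms \<open>\<zeta>\<close>, \<open>cnj \<zeta>\<close>, \<open>\<eta>\<close>, \<open>cnj \<eta>\<close>; conjugation
    swaps two pairs of rows of \<open>N\<close>, so \<open>det N\<close> is real and only \<open>Im (det M)\<close> matters.\<close>
  define M :: "complex^4^4" where "M = (\<chi> i j.
     let z = (if j = 1 then 1 else 0); z' = (if j = 2 then 1 else 0);
         w = (if j = 3 then 1 else 0); w' = (if j = 4 then 1 else 0)
     in if i = 1 then A1 e z z' (a * z + b * w) (cnj a * z' + cnj b * w')
        else if i = 2 then A1 f z z' (a * z + b * w) (cnj a * z' + cnj b * w')
        else if i = 3 then A2 e w w' (b * z + c * w) (cnj b * z' + cnj c * w')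
        else A2 f w w' (b * z + c * w) (cnj b * z' + cnj c * w'))"
  define N :: "complex^4^4" where "N = (\<chi> i j.
     if i = 1 then \<zeta> j else if i = 2 then cnj (\<zeta> j) else if i = 3 then \<eta> j else cnj (\<eta> j))"
  have coframe: "of_real (dq j x) + \<i> * of_real (dp j x) = e (q_pair j k x) (cnj (q_pair j k x)) (p_pair j k x) (cnj (p_pair j k x))"
    "of_real (dq k x) + \<i> * of_real (dp k x) = f (q_pair j k x) (cnj (q_pair j k x)) (p_pair j k x) (cnj (p_pair j k x))" for j k x
    by (simp_all add: complex_eq_iff e_def f_def q_pair_def p_pair_def)
  have pairs: "q_pair 1 2 (v j) = \<i> * \<beta> * \<kappa> * (\<zeta> j + (a * \<zeta> j + b * \<eta> j))"
    "p_pair 1 2 (v j) = \<i> * \<alpha> * \<kappa> * (\<zeta> j - (a * \<zeta> j + b * \<eta> j))"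
    "q_pair 3 4 (v j) = \<beta> * \<kappa> * (\<eta> j + (b * \<zeta> j + c * \<eta> j))"
    "p_pair 3 4 (v j) = \<alpha> * \<kappa> * ((b * \<zeta> j + c * \<eta> j) - \<eta> j)" for j
    unfolding F_map_coords[OF \<alpha>0 v, symmetric]
    by (simp_all add: \<kappa>_def divide_inverse inv\<alpha>)
  have cnj\<beta>: "cnj \<beta> = \<alpha>" "cnj \<alpha> = \<beta>"
    by (simp_all add: \<beta>_def)
  \<comment> \<open>Each form is real-linear in the tangent vector, hence a complex combination of
    \<open>\<zeta>\<close>, \<open>\<eta>\<close> and their conjugates; its coefficients are a row
    of \<open>M\<close>.\<close>
  have "(\<chi> i j. of_real (dq i (v j)) + \<i> * of_real (dp i (v j))) = M ** N"
    unfolding vec_eq_iff forall_4[where P = "\<lambda>i. \<forall>j. _ i j"]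
    by (auto simp: matrix_matrix_mult_def sum_4 M_def N_def Let_def coframe(1)[where j = 1 and k = 2] coframe(2)[where j = 1 and k = 2]
        coframe(1)[where j = 3 and k = 4] coframe(2)[where j = 3 and k = 4] pairs A1_def A2_def cnj\<beta> \<kappa>(2))
       (auto simp: e_def f_def algebra_simps add_divide_distrib diff_divide_distrib)
  then have det: "omega_SLAG v = Im (det M * det N)"
    by (simp add: omega_SLAG_def wedge_def det_mul)
  have "cnj (det N) = det N"
    by (simp add: det_4_Laplace N_def algebra_simps)
  then obtain n where n: "det N = of_real n"
    by (metis Reals_cnj_iff Reals_cases)
  define h where "h = a * cnj a"
  have hc: "c * cnj c = h"
    using ac by (simp add: h_def complex_norm_square[symmetric])
  have M_entries:
    "M$1$1 = A1 e 1 0 a 0" "M$1$2 = A1 e 0 1 0 (cnj a)" "M$1$3 = A1 e 0 0 b 0" "M$1$4 = A1 e 0 0 0 (cnj b)"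
    "M$2$1 = A1 f 1 0 a 0" "M$2$2 = A1 f 0 1 0 (cnj a)" "M$2$3 = A1 f 0 0 b 0" "M$2$4 = A1 f 0 0 0 (cnj b)"
    "M$3$1 = A2 e 0 0 b 0" "M$3$2 = A2 e 0 0 0 (cnj b)" "M$3$3 = A2 e 1 0 c 0" "M$3$4 = A2 e 0 1 0 (cnj c)"
    "M$4$1 = A2 f 0 0 b 0" "M$4$2 = A2 f 0 0 0 (cnj b)" "M$4$3 = A2 f 1 0 c 0" "M$4$4 = A2 f 0 1 0 (cnj c)"
    by (simp_all add: M_def)
  have "det M =
      (1/2 * \<i> * (1 + a * cnj a) - 1/4 * s * (1 - a * cnj a)) * (1/2 * \<i> * (1 + c * cnj c) + 1/4 * s * (1 - c * cnj c))
      - 9/8 * (b * cnj b)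
      - (1/2 * \<i> + 1/4 * s) * (1/2 * \<i> - 1/4 * s) * (a * cnj b * (c * cnj b) + b * cnj a * (b * cnj c) - b * cnj b * (b * cnj b))"
    unfolding det_4_Laplace M_entries minor1 minor2 by (simp add: algebra_simps add_divide_distrib diff_divide_distrib)
  \<comment> \<open>The condition on the Hessian enters here. In general the imaginary part of
    \<open>det M\<close> is sqrt 5/4 times the difference of the squared moduli of \<open>a\<close>
    and \<open>c\<close>; with both squares equal to \<open>h\<close>, the first product has the
    form (iA - B)(iA + B) with real A and B.\<close>
  also have "\<dots> = (1/2 * \<i> * (1 + h) - 1/4 * s * (1 - h)) * (1/2 * \<i> * (1 + h) + 1/4 * s * (1 - h))
      - 9/8 * (b * cnj b)
      - (1/2 * \<i> + 1/4 * s) * (1/2 * \<i> - 1/4 * s) * (a * cnj b * (c * cnj b) + b * cnj a * (b * cnj c) - b * cnj b * (b * cnj b))"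
    by (simp only: hc flip: h_def)
  finally have M: "det M = \<dots>" .
  have "cnj h = h"
    by (simp add: h_def)
  then have "cnj (det M) = det M"
    unfolding M using s(3) by (simp add: algebra_simps)
  then obtain m where m: "det M = of_real m"
    by (metis Reals_cnj_iff Reals_cases)
  show ?thesis
    by (simp add: det m n)
qed

subsection \<open>The graph of the gradient\<close>

lemma bounded_linear_F_map: "bounded_linear (F_map \<alpha>)"
  using linear_F_map by (simp add: linear_conv_bounded_linear)

lemma bounded_linear_F_map_base: "bounded_linear (\<lambda>x. (fst (F_map \<alpha> x), fst (snd (F_map \<alpha> x))))"
  by (intro bounded_linear_Pair bounded_linear_compose[OF bounded_linear_fst]
      bounded_linear_compose[OF bounded_linear_snd] bounded_linear_F_map)

text \<open>Brings the preimage into the form of the shear lemma: \<open>B\<close> is the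
  \<open>z\<close>-part of \<open>F_map\<close>, and the subspace is the preimage of the zero
  section \<open>u = 0\<close>.\<close>

lemma F_map_vimage_L_graph:
  assumes "\<alpha> \<noteq> 0"
  shows "F_map \<alpha> -` L_graph \<phi> U =
    {x. (fst (F_map \<alpha> x), fst (snd (F_map \<alpha> x))) \<in> U \<and>
       x - F_inv \<alpha> (0, 0, pd1 \<phi> (fst (F_map \<alpha> x), fst (snd (F_map \<alpha> x))), pd2 \<phi> (fst (F_map \<alpha> x), fst (snd (F_map \<alpha> x))))
         \<in> range (\<lambda>(z1, z2). F_inv \<alpha> (z1, z2, 0, 0))}"
proof -
  have "x - F_inv \<alpha> (0, 0, g1, g2) \<in> range (\<lambda>(z1, z2). F_inv \<alpha> (z1, z2, 0, 0)) \<longleftrightarrow> snd (snd (F_map \<alpha> x)) = (g1, g2)" for x g1 g2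
  proof -
    have "x - F_inv \<alpha> (0, 0, g1, g2) = F_inv \<alpha> w \<longleftrightarrow> F_map \<alpha> x - (0, 0, g1, g2) = w" for w
      by (metis F_inv_F_map[OF assms] F_map_F_inv[OF assms] linear_diff[OF linear_F_map])
    then show ?thesis
      by (cases "F_map \<alpha> x") (auto simp: image_iff)
  qed
  moreover have "F_map \<alpha> x \<in> L_graph \<phi> U \<longleftrightarrow> (fst (F_map \<alpha> x), fst (snd (F_map \<alpha> x))) \<in> U \<and> snd (snd (F_map \<alpha> x)) =
      (pd1 \<phi> (fst (F_map \<alpha> x), fst (snd (F_map \<alpha> x))), pd2 \<phi> (fst (F_map \<alpha> x), fst (snd (F_map \<alpha> x))))" for x
    by (cases "F_map \<alpha> x") (auto simp: L_graph_def)
  ultimately show ?thesis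
    by (simp only: vimage_def)
qed

text \<open>Differentiating u = grad \<phi>(z) along a curve in the preimage expresses the
  \<open>u\<close>-velocity by the Hessian; \<open>pd_commute\<close> makes it symmetric.\<close>

lemma tangent_space_L_graph:
  assumes "separately_holomorphic_on \<phi> U" "open U"
    and x: "F_map \<alpha> x \<in> L_graph \<phi> U" and v: "v \<in> tangent_space (F_map \<alpha> -` L_graph \<phi> U) x"
  defines "z \<equiv> (fst (F_map \<alpha> x), fst (snd (F_map \<alpha> x)))"
  obtains \<zeta> \<eta> where "F_map \<alpha> v = (\<zeta>, \<eta>,
    pd1 (pd1 \<phi>) z * \<zeta> + pd2 (pd1 \<phi>) z * \<eta>, pd2 (pd1 \<phi>) z * \<zeta> + pd2 (pd2 \<phi>) z * \<eta>)"
proof -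
  obtain \<gamma> where \<gamma>: "\<gamma> 0 = x" "\<forall>\<^sub>F t in nhds 0. \<gamma> t \<in> F_map \<alpha> -` L_graph \<phi> U"
      "(\<gamma> has_vector_derivative v) (at 0)"
    using v by (auto simp: tangent_space_def)
  have "z \<in> U"
    using x by (auto simp: L_graph_def z_def)
  define \<zeta> \<eta> \<mu> \<nu> where defs: "\<zeta> = fst (F_map \<alpha> v)" "\<eta> = fst (snd (F_map \<alpha> v))"
    "\<mu> = fst (snd (snd (F_map \<alpha> v)))" "\<nu> = snd (snd (snd (F_map \<alpha> v)))"
  define Z where "Z = (\<lambda>y. (fst (F_map \<alpha> y), fst (snd (F_map \<alpha> y))))"
  have "bounded_linear Z"
    unfolding Z_def by (rule bounded_linear_F_map_base)
  from bounded_linear.has_vector_derivative[OF this \<gamma>(3)]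
  have Z': "((\<lambda>t. Z (\<gamma> t)) has_derivative (\<lambda>h. h *\<^sub>R (\<zeta>, \<eta>))) (at 0)"
    by (simp add: Z_def defs has_vector_derivative_def)
  have chain: "((\<lambda>t. g (Z (\<gamma> t))) has_vector_derivative pd1 g z * \<zeta> + pd2 g z * \<eta>) (at 0)"
    if "separately_holomorphic_on g U" for g
  proof -
    have "(g has_derivative (\<lambda>h. pd1 g z * fst h + pd2 g z * snd h)) (at (Z (\<gamma> 0)))"
      using separately_holomorphic_has_derivative[OF that assms(2) \<open>z \<in> U\<close>] by (simp add: \<gamma>(1) Z_def z_def)
    from has_derivative_compose[OF Z' this]
    show ?thesis
      by (simp add: has_vector_derivative_def algebra_simps)
  qed
  have deriv: "((\<lambda>t. fst (snd (snd (F_map \<alpha> (\<gamma> t))))) has_vector_derivative \<mu>) (at 0)"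
    "((\<lambda>t. snd (snd (snd (F_map \<alpha> (\<gamma> t))))) has_vector_derivative \<nu>) (at 0)"
    unfolding defs
    by (intro bounded_linear.has_vector_derivative[OF bounded_linear_fst] bounded_linear.has_vector_derivative[OF bounded_linear_snd]
        bounded_linear.has_vector_derivative[OF bounded_linear_F_map] \<gamma>(3))+
  have ev: "\<forall>\<^sub>F t in nhds 0. fst (snd (snd (F_map \<alpha> (\<gamma> t)))) = pd1 \<phi> (Z (\<gamma> t))"
    "\<forall>\<^sub>F t in nhds 0. snd (snd (snd (F_map \<alpha> (\<gamma> t)))) = pd2 \<phi> (Z (\<gamma> t))"
    by (rule eventually_mono[OF \<gamma>(2)], force simp: L_graph_def Z_def)+
  \<comment> \<open>The graph equation holds only for \<open>t\<close> near 0, including 0 itself,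
    which suffices for the derivative there.\<close>
  have transfer: "(g has_vector_derivative d) (at 0)"
    if "(f has_vector_derivative d) (at 0)" "\<forall>\<^sub>F t in nhds 0. f t = g t" for f g :: "real \<Rightarrow> complex" and d
    using has_vector_derivative_cong_ev[of UNIV f g 0 d] eventually_nhds_x_imp_x[OF that(2)] that by simp
  have "((\<lambda>t. pd1 \<phi> (Z (\<gamma> t))) has_vector_derivative \<mu>) (at 0)"
    "((\<lambda>t. pd2 \<phi> (Z (\<gamma> t))) has_vector_derivative \<nu>) (at 0)"
    by (rule transfer[OF deriv(1) ev(1)], rule transfer[OF deriv(2) ev(2)])
  then have "\<mu> = pd1 (pd1 \<phi>) z * \<zeta> + pd2 (pd1 \<phi>) z * \<eta>" "\<nu> = pd1 (pd2 \<phi>) z * \<zeta> + pd2 (pd2 \<phi>) z * \<eta>"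
    using chain[OF separately_holomorphic_pd1[OF assms(1,2)]] chain[OF separately_holomorphic_pd2[OF assms(1,2)]]
    by (auto intro: vector_derivative_unique_at)
  then show thesis
    using that[of \<zeta> \<eta>] pd_commute[OF assms(1,2) \<open>z \<in> U\<close>] by (simp add: defs prod_eq_iff)
qed

lemma embedded_submanifold_L_graph:
  assumes "\<alpha> \<noteq> 0" "separately_holomorphic_on \<phi> U" "open U"
  shows "embedded_submanifold 4 (F_map \<alpha> -` L_graph \<phi> U)"
proof -
  have G: "bounded_linear (F_inv \<alpha>)"
    using linear_F_inv[OF assms(1)] by (simp add: linear_conv_bounded_linear)
  define Z where "Z = (\<lambda>y. (fst (F_map \<alpha> y), fst (snd (F_map \<alpha> y))))"
  define \<kappa> where "\<kappa> = (\<lambda>y. F_inv \<alpha> (0, 0, pd1 \<phi> y, pd2 \<phi> y))"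
  define S where "S = range (\<lambda>(z1, z2). F_inv \<alpha> (z1, z2, 0, 0))"
  have Z: "bounded_linear Z"
    unfolding Z_def by (rule bounded_linear_F_map_base)
  have Zpre: "open (Z -` U)"
    using assms(3) Z by (auto intro: open_vimage linear_continuous_on)
  have emb: "bounded_linear (\<lambda>w. F_inv \<alpha> (0, 0, w, 0))" "bounded_linear (\<lambda>w. F_inv \<alpha> (0, 0, 0, w))"
      "bounded_linear (\<lambda>w. F_inv \<alpha> (fst w, snd w, 0, 0))"
    by (intro bounded_linear_compose[OF G] bounded_linear_Pair bounded_linear_zero bounded_linear_ident
          bounded_linear_fst bounded_linear_snd)+
  have smooth: "Ck_on k (Z -` U) (\<lambda>x. \<kappa> (Z x))" for k
  proof -
    \<comment> \<open>Split so that each summand is a linear image of a single holomorphic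
      function.\<close>
    have "\<kappa> y = F_inv \<alpha> (0, 0, pd1 \<phi> y, 0) + F_inv \<alpha> (0, 0, 0, pd2 \<phi> y)" for y
      using linear_add[OF linear_F_inv[OF assms(1)], of "(0, 0, pd1 \<phi> y, 0)" "(0, 0, 0, pd2 \<phi> y)"]
      by (simp add: \<kappa>_def)
    then show ?thesis
      using assms(2,3) Ck_on_add[OF Zpre Ck_on_linear_compose[OF assms(3) emb(1) Z] Ck_on_linear_compose[OF assms(3) emb(2) Z], of k "pd1 \<phi>" "pd2 \<phi>"]
      by (simp add: separately_holomorphic_imp_Ck_on separately_holomorphic_pd1 separately_holomorphic_pd2)
  qed
  have S: "S = range (\<lambda>w. F_inv \<alpha> (fst w, snd w, 0, 0))"
    by (simp add: S_def case_prod_unfold)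
  have lin: "linear (\<lambda>w. F_inv \<alpha> (fst w, snd w, 0, 0))"
    using emb(3) by (rule bounded_linear.linear)
  have inj: "inj (\<lambda>w. F_inv \<alpha> (fst w, snd w, 0, 0))"
  proof (rule injI)
    fix w w' assume "F_inv \<alpha> (fst w, snd w, 0, 0) = F_inv \<alpha> (fst w', snd w', 0, 0)"
    then have "F_map \<alpha> (F_inv \<alpha> (fst w, snd w, 0, 0)) = F_map \<alpha> (F_inv \<alpha> (fst w', snd w', 0, 0))"
      by simp
    then show "w = w'"
      by (simp add: F_map_F_inv[OF assms(1)] prod_eq_iff)
  qed
  have "embedded_submanifold 4 {x. Z x \<in> U \<and> x - \<kappa> (Z x) \<in> S}"
  proof (rule shear_preimage_embedded_submanifold[OF assms(3) Z _ smooth])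
    show "Z (\<kappa> y) = 0" for y
      by (simp add: Z_def \<kappa>_def F_map_F_inv[OF assms(1)] zero_prod_def)
    show "subspace S"
      unfolding S using lin by (intro linear_subspace_image subspace_UNIV)
    have "dim S = dim (UNIV :: (complex \<times> complex) set)"
      unfolding S using lin inj by (intro dim_image_eq) auto
    then show "dim S = 4"
      by simp
  qed
  then show ?thesis
    by (simp add: F_map_vimage_L_graph[OF assms(1)] Z_def \<kappa>_def S_def)
qed

theorem proposition1:
  fixes \<alpha> :: complex
    and \<phi> :: "complex \<times> complex \<Rightarrow> complex"
    and U :: "(complex \<times> complex) set"
  assumes "\<alpha>\<^sup>2 = (1 + 2 * \<i>) / of_real (sqrt 5)"
    and "open U"
    and "holomorphic2_on \<phi> U"
    and "\<And>z. z \<in> U \<Longrightarrow> (cmod (pd1 (pd1 \<phi>) z))\<^sup>2 - (cmod (pd2 (pd2 \<phi>) z))\<^sup>2 = 0"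
  shows "special_lagrangian (F_map \<alpha> -` L_graph \<phi> U)"
proof -
  have "1 + 2 * \<i> \<noteq> 0"
    by (simp add: complex_eq_iff)
  then have \<alpha>: "\<alpha> \<noteq> 0"
    using assms(1) by auto
  have \<phi>: "separately_holomorphic_on \<phi> U"
    using assms(3) by (rule holomorphic2_imp_separately)
  note tangent = tangent_space_L_graph[OF \<phi> assms(2)]
  show ?thesis
    unfolding special_lagrangian_def
  proof (intro conjI ballI allI impI)
    show "embedded_submanifold 4 (F_map \<alpha> -` L_graph \<phi> U)"
      using \<alpha> \<phi> assms(2) by (rule embedded_submanifold_L_graph)
  next
    fix x v w
    assume x: "x \<in> F_map \<alpha> -` L_graph \<phi> U"
      and v: "v \<in> tangent_space (F_map \<alpha> -` L_graph \<phi> U) x"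
      and w: "w \<in> tangent_space (F_map \<alpha> -` L_graph \<phi> U) x"
    have x': "F_map \<alpha> x \<in> L_graph \<phi> U" using x by simp
    \<comment> \<open>After substitution all terms cancel because the same mixed derivative stands
      in both off-diagonal places.\<close>
    show "Omega v w = 0"
      by (rule tangent[OF x' v], rule tangent[OF x' w]) (simp add: Omega_F_map[OF \<alpha>] algebra_simps)
  next
    fix x and v :: "4 \<Rightarrow> cotangent4"
    assume x: "x \<in> F_map \<alpha> -` L_graph \<phi> U"
      and v: "\<forall>j. v j \<in> tangent_space (F_map \<alpha> -` L_graph \<phi> U) x"
    define z where "z = (fst (F_map \<alpha> x), fst (snd (F_map \<alpha> x)))"
    have x': "F_map \<alpha> x \<in> L_graph \<phi> U" using x by simp
    have "z \<in> U"
      using x by (auto simp: L_graph_def z_def)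
    then have cmod: "cmod (pd1 (pd1 \<phi>) z) = cmod (pd2 (pd2 \<phi>) z)"
      using assms(4)[of z] by (simp add: power2_eq_iff_nonneg)
    have "\<exists>\<zeta> \<eta>. F_map \<alpha> (v j) = (\<zeta>, \<eta>,
        pd1 (pd1 \<phi>) z * \<zeta> + pd2 (pd1 \<phi>) z * \<eta>, pd2 (pd1 \<phi>) z * \<zeta> + pd2 (pd2 \<phi>) z * \<eta>)" for j
      using tangent[OF x' v[rule_format, of j]] unfolding z_def by blast
    then obtain \<zeta> \<eta> where "\<And>j. F_map \<alpha> (v j) = (\<zeta> j, \<eta> j,
        pd1 (pd1 \<phi>) z * \<zeta> j + pd2 (pd1 \<phi>) z * \<eta> j, pd2 (pd1 \<phi>) z * \<zeta> j + pd2 (pd2 \<phi>) z * \<eta> j)"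
      by metis
    then show "omega_SLAG v = 0"
      by (rule omega_SLAG_eq_0[OF assms(1) cmod])
  qed
qed

end
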